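(* Let $\lambda\in\mathbb{R}$, let $x,z\in\mathbb{C}$ with $z\ne0$, and let $f_{\lambda}(t)=\sum_{k=0}^{\infty}a_{k}(t)_{k,\lambda}$ be a degenerate formal power series. Then $$\sum_{n=1}^{\infty}\frac{x^{n}}{n}\bigg\{\sum_{k=0}^{n}\binom{n}{k}(-1)^{k}f_{\lambda}(zk)\bigg\}=\sum_{m=1}^{\infty}a_{m}z^{m}\sum_{p=1}^{m}S_{2,\frac{\lambda}{z}}(m,p)(-1)^{p}(p-1)!\,x^{p},$$ understood formally in the coefficients $a_m$, i.e. for each $m\ge 0$ the coefficients of $a_m$ on the two sides are equal.
   Context: For a complex number $\mu$, the $\mu$-falling factorials are $(x)_{0,\mu}=1$ and $(x)_{n,\mu}=x(x-\mu)(x-2\mu)\cdots(x-(n-1)\mu)$ for $n\ge1$; the ordinary falling factorials are $(x)_0=1$, $(x)_n=x(x-1)\cdots(x-n+1)$ for $n\ge 1$. The degenerate Stirling numbers of the second kind $S_{2,\mu}(n,k)$ are defined by the polynomial identity $(x)_{n,\mu}=\sum_{k=0}^{n}S_{2,\mu}(n,k)(x)_{k}$ for $n\ge0$, with $S_{2,\mu}(n,k)=0$ for $k>n$. A degenerate formal power series is an expression $f_{\lambda}(t)=\sum_{k=0}^{\infty}a_{k}(t)_{k,\lambda}$ with coefficients $a_0,a_1,a_2,\dots$; for a number $w$, $f_\lambda(w)$ denotes the formal sum $\sum_{m=0}^{\infty}a_m (w)_{m,\lambda}$. Each side of an identity is regarded as a formal linear combination $\sum_{m\ge0}a_m c_m$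 with $c_m\in\mathbb{C}$; the outer sum over $n$ is carried out coefficientwise in the $a_m$ (for each $m$, the coefficient of $a_m$ in the inner braces vanishes for $n>m$, so only finitely many $n$ contribute). *)

theory Defs
  imports Complex_Main "HOL-Library.Function_Algebras"
begin

definition falling :: "complex \<Rightarrow> nat \<Rightarrow> complex" where
  "falling x n = (\<Prod>i<n. x - of_nat i)"

definition mu_falling :: "complex \<Rightarrow> complex \<Rightarrow> nat \<Rightarrow> complex" where
  "mu_falling \<mu> x n = (\<Prod>i<n. x - of_nat i * \<mu>)"

lemma falling_Suc: "falling x (Suc k) = falling x k * (x - of_nat k)"
  by (simp add: falling_def)

lemma mu_falling_Suc: "mu_falling \<mu> x (Suc n) = mu_falling \<mu> x n * (x - of_nat n * \<mu>)"
  by (simp add: mu_falling_def)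

lemma falling_of_nat_eq_0: "j < k \<Longrightarrow> falling (of_nat j) k = 0"
  unfolding falling_def by (rule prod_zero) auto

lemma falling_of_nat_self: "falling (of_nat k) k \<noteq> 0"
  by (auto simp: falling_def)


text \<open>The identity between polynomials over the complex numbers is stated as an identity of
  values at all complex points.\<close>

definition is_deg_stirling2 :: "complex \<Rightarrow> nat \<Rightarrow> (nat \<Rightarrow> complex) \<Rightarrow> bool" where
  "is_deg_stirling2 \<mu> n s \<longleftrightarrow>
     (\<forall>x. mu_falling \<mu> x n = (\<Sum>k\<le>n. s k * falling x k)) \<and> (\<forall>k>n. s k = 0)"

definition deg_stirling2 :: "complex \<Rightarrow> nat \<Rightarrow> nat \<Rightarrow> complex" where
  "deg_stirling2 \<mu> n = (THE s. is_deg_stirling2 \<mu> n s)"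

lemma is_deg_stirling2_exists: "\<exists>s. is_deg_stirling2 \<mu> n s"
proof (induction n)
  case 0
  have "is_deg_stirling2 \<mu> 0 (\<lambda>k. if k = 0 then 1 else 0)"
    by (simp add: is_deg_stirling2_def mu_falling_def falling_def)
  then show ?case by blast
next
  case (Suc n)
  then obtain s where s: "\<And>x. mu_falling \<mu> x n = (\<Sum>k\<le>n. s k * falling x k)"
    and s0: "\<And>k. k > n \<Longrightarrow> s k = 0"
    by (auto simp: is_deg_stirling2_def)
  define t where
    "t k = (if k = 0 then 0 else s (k - 1)) + (of_nat k - of_nat n * \<mu>) * s k" for k
  have "mu_falling \<mu> x (Suc n) = (\<Sum>k\<le>Suc n. t k * falling x k)" for x
  proof -
    have "(\<Sum>k\<le>Suc n. t k * falling x k) =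
        (\<Sum>k\<le>Suc n. (if k = 0 then 0 else s (k - 1)) * falling x k)
        + (\<Sum>k\<le>Suc n. (of_nat k - of_nat n * \<mu>) * s k * falling x k)"
      by (simp only: t_def distrib_right sum.distrib)
    also have "(\<Sum>k\<le>Suc n. (if k = 0 then 0 else s (k - 1)) * falling x k)
        = (\<Sum>k\<le>n. s k * falling x (Suc k))"
      by (subst sum.atMost_Suc_shift) simp
    also have "(\<Sum>k\<le>Suc n. (of_nat k - of_nat n * \<mu>) * s k * falling x k)
        = (\<Sum>k\<le>n. (of_nat k - of_nat n * \<mu>) * s k * falling x k)"
      by (simp add: s0)
    also have "(\<Sum>k\<le>n. s k * falling x (Suc k))
        + (\<Sum>k\<le>n. (of_nat k - of_nat n * \<mu>) * s k * falling x k)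
        = (\<Sum>k\<le>n. s k * falling x k) * (x - of_nat n * \<mu>)"
      unfolding sum.distrib[symmetric] sum_distrib_right
      by (rule sum.cong) (auto simp: falling_Suc algebra_simps)
    finally show ?thesis by (simp add: mu_falling_Suc s)
  qed
  moreover have "\<forall>k>Suc n. t k = 0" by (auto simp: t_def s0)
  ultimately show ?case unfolding is_deg_stirling2_def by blast
qed

lemma is_deg_stirling2_unique:
  assumes "is_deg_stirling2 \<mu> n s" and "is_deg_stirling2 \<mu> n t"
  shows "s = t"
proof
  fix k
  show "s k = t k"
  proof (induction k rule: less_induct)
    case (less k)
    show ?case
    proof (cases "k \<le> n")
      case False
      with assms show ?thesis by (simp add: is_deg_stirling2_def)
    next
      case True
      have split: "(\<Sum>j\<le>n. u j * falling (of_nat k) j) =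
          (\<Sum>j<k. u j * falling (of_nat k) j) + u k * falling (of_nat k) k" for u
      proof -
        have "(\<Sum>j\<le>n. u j * falling (of_nat k) j) = (\<Sum>j\<le>k. u j * falling (of_nat k) j)"
          by (rule sum.mono_neutral_right) (use True in \<open>auto simp: falling_of_nat_eq_0\<close>)
        then show ?thesis by (simp add: lessThan_Suc_atMost[symmetric])
      qed
      have "(\<Sum>j\<le>n. s j * falling (of_nat k) j) = (\<Sum>j\<le>n. t j * falling (of_nat k) j)"
        using assms by (metis is_deg_stirling2_def)
      moreover have "(\<Sum>j<k. s j * falling (of_nat k) j) = (\<Sum>j<k. t j * falling (of_nat k) j)"
        by (rule sum.cong) (auto simp: less)
      ultimately show ?thesis by (simp add: split falling_of_nat_self)
    qed
  qed
qed

lemma is_deg_stirling2_deg_stirling2: "is_deg_stirling2 \<mu> n (deg_stirling2 \<mu> n)"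
  unfolding deg_stirling2_def
proof (rule theI'[where P = "is_deg_stirling2 \<mu> n"])
  show "\<exists>!s. is_deg_stirling2 \<mu> n s"
    using is_deg_stirling2_exists is_deg_stirling2_unique by (metis (no_types))
qed


text \<open>The coefficients \<open>a\<^sub>0, a\<^sub>1, \<dots>\<close> of a degenerate formal power series are treated as
  indeterminates. The function \<open>c\<close> represents the formal linear combination
  \<open>\<Sum>m. a\<^sub>m c\<^sub>m\<close>, so that \<open>c m\<close> is the coefficient of \<open>a\<^sub>m\<close>; addition and \<open>0\<close> are pointwise.\<close>

type_synonym formal_comb = "nat \<Rightarrow> complex"

definition indet :: "nat \<Rightarrow> formal_comb" where
  "indet m = (\<lambda>j. if j = m then 1 else 0)"

definition scale :: "complex \<Rightarrow> formal_comb \<Rightarrow> formal_comb"  (infixr \<open>\<odot>\<close> 70) where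
  "c \<odot> v = (\<lambda>m. c * v m)"

text \<open>Infinite sums of formal linear combinations are taken coefficientwise and are meaningful
  only if every coefficient receives finitely many nonzero contributions.\<close>

definition formal_summable :: "(nat \<Rightarrow> formal_comb) \<Rightarrow> nat set \<Rightarrow> bool" where
  "formal_summable g A \<longleftrightarrow> (\<forall>m. finite {n \<in> A. g n m \<noteq> 0})"

definition formal_sum :: "(nat \<Rightarrow> formal_comb) \<Rightarrow> nat set \<Rightarrow> formal_comb" where
  "formal_sum g A = (\<lambda>m. \<Sum>n | n \<in> A \<and> g n m \<noteq> 0. g n m)"

definition deg_series :: "real \<Rightarrow> complex \<Rightarrow> formal_comb" where
  "deg_series lam w = formal_sum (\<lambda>k. mu_falling (of_real lam) w k \<odot> indet k) UNIV"

lemma formal_summable_indet: "formal_summable (\<lambda>k. c k \<odot> indet k) A"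
  unfolding formal_summable_def
proof
  fix m
  show "finite {n \<in> A. (c n \<odot> indet n) m \<noteq> 0}"
    by (rule finite_subset[of _ "{m}"]) (auto simp: scale_def indet_def)
qed

lemma formal_sum_indet: "formal_sum (\<lambda>k. c k \<odot> indet k) A m = (if m \<in> A then c m else 0)"
proof -
  have "{n. n \<in> A \<and> (c n \<odot> indet n) m \<noteq> 0} = (if m \<in> A \<and> c m \<noteq> 0 then {m} else {})"
    by (auto simp: scale_def indet_def)
  then show ?thesis by (simp add: formal_sum_def scale_def indet_def)
qed

lemma deg_series_coeff: "deg_series lam w m = mu_falling (of_real lam) w m"
  by (simp add: deg_series_def formal_sum_indet)

end

theory Submission
  imports Defs
begin

text \<open>The braces on the left are, up to sign, an \<open>n\<close>-th finite difference at \<open>0\<close>, and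
  finite differences are diagonal on the falling factorials: the alternating binomial sum of
  \<open>(k)\<^sub>p\<close> vanishes unless \<open>p = n\<close>, when it is \<open>(-1)\<^sup>n n!\<close>
  (lemma \<open>alternating_binomial_sum_falling\<close>). The coefficient of \<open>a\<^sub>m\<close> in
  \<open>f\<^sub>\<lambda>(zk)\<close> is the degenerate factorial \<open>(zk)\<^sub>m\<close> of step \<open>\<lambda>\<close>. Pulling \<open>z\<close> out of every
  factor turns it into \<open>z\<^sup>m\<close> times the factorial of \<open>k\<close> of step \<open>\<lambda>/z\<close>, whose coordinates in the
  basis of falling factorials are by definition the degenerate Stirling numbers. Hence the
  braces contribute \<open>z\<^sup>m S(m,n) (-1)\<^sup>n n!\<close> to \<open>a\<^sub>m\<close>; weighted by \<open>x\<^sup>n/n\<close> this is the term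
  \<open>p = n\<close> of the right-hand side. It vanishes for \<open>n > m\<close>, so the sum over \<open>n\<close> is finite for
  each \<open>m\<close>.\<close>

lemma falling_of_nat_Suc_Suc:
  "falling (of_nat (Suc k)) (Suc p) = of_nat (Suc k) * falling (of_nat k) p"
  unfolding falling_def by (subst prod.lessThan_Suc_shift) simp

text \<open>The absorption law \<open>(k+1) * binomial(n+1,k+1) = (n+1) * binomial(n,k)\<close>
  lowers \<open>n\<close> and \<open>p\<close> together, at the price of the factor \<open>-(n+1)\<close>; for \<open>p = 0\<close> what remains is
  the expansion of \<open>(1 - 1)\<^sup>n\<close>.\<close>

lemma alternating_binomial_sum_falling:
  "(\<Sum>k\<le>n. of_nat (n choose k) * (- 1) ^ k * falling (of_nat k) p)
     = (if n = p then (- 1) ^ n * fact n else 0)"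
proof (induction p arbitrary: n)
  case 0
  show ?case
    using choose_alternating_sum[of n, where 'a = complex]
    by (cases "n = 0") (simp_all add: falling_def mult.commute)
next
  case (Suc p)
  show ?case
  proof (cases n)
    case 0
    then show ?thesis
      using falling_of_nat_eq_0[of 0 "Suc p"] by simp
  next
    case n: (Suc m)
    have absorb: "of_nat (Suc m choose Suc k) * (of_nat (Suc k) :: complex)
        = of_nat (Suc m) * of_nat (m choose k)" for k
      by (metis Suc_times_binomial_eq of_nat_mult)
    have "(\<Sum>k\<le>n. of_nat (n choose k) * (- 1) ^ k * falling (of_nat k) (Suc p))
        = (\<Sum>k\<le>m. of_nat (Suc m choose Suc k) * (- 1) ^ Suc k
              * falling (of_nat (Suc k)) (Suc p))"
      using falling_of_nat_eq_0[of 0 "Suc p"]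
      unfolding n by (subst sum.atMost_Suc_shift) simp
    also have "\<dots> = (\<Sum>k\<le>m. - of_nat (Suc m)
              * (of_nat (m choose k) * (- 1) ^ k * falling (of_nat k) p))"
    proof (rule sum.cong[OF refl])
      fix k
      have "of_nat (Suc m choose Suc k) * (- 1) ^ Suc k * falling (of_nat (Suc k)) (Suc p)
          = - ((of_nat (Suc m choose Suc k) * of_nat (Suc k)) * (- 1) ^ k * falling (of_nat k) p)"
        by (simp only: falling_of_nat_Suc_Suc power_Suc mult_minus_left mult_minus_right mult_1_left
            mult.assoc mult.left_commute)
      then show "of_nat (Suc m choose Suc k) * (- 1) ^ Suc k * falling (of_nat (Suc k)) (Suc p)
          = - of_nat (Suc m) * (of_nat (m choose k) * (- 1) ^ k * falling (of_nat k) p)"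
        by (simp only: absorb mult_minus_left mult.assoc)
    qed
    also have "\<dots> = - of_nat (Suc m) * (if m = p then (- 1) ^ m * fact m else 0)"
      by (simp only: sum_distrib_left[symmetric] Suc.IH)
    also have "\<dots> = (if n = Suc p then (- 1) ^ n * fact n else 0)"
      by (simp add: n algebra_simps)
    finally show ?thesis .
  qed
qed

lemma mu_falling_scale:
  assumes "z \<noteq> 0"
  shows "mu_falling \<mu> (z * w) m = z ^ m * mu_falling (\<mu> / z) w m"
  by (induction m) (use assms in \<open>simp_all add: mu_falling_def field_simps\<close>)

lemma mu_falling_eq_sum_deg_stirling2:
  "mu_falling \<mu> w m = (\<Sum>p\<le>m. deg_stirling2 \<mu> m p * falling w p)"
  using is_deg_stirling2_deg_stirling2[of \<mu> m] by (simp add: is_deg_stirling2_def)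

lemma deg_stirling2_eq_0: "m < p \<Longrightarrow> deg_stirling2 \<mu> m p = 0"
  using is_deg_stirling2_deg_stirling2[of \<mu> m] by (simp add: is_deg_stirling2_def)

text \<open>Extracting the \<open>n\<close>-th coordinate in the basis of falling factorials: the degenerate
  analogue of the explicit formula for Stirling numbers of the second kind as alternating sums
  of powers.\<close>

lemma alternating_binomial_sum_mu_falling:
  "(\<Sum>k\<le>n. of_nat (n choose k) * (- 1) ^ k * mu_falling \<mu> (of_nat k) m)
     = deg_stirling2 \<mu> m n * (- 1) ^ n * fact n"
proof -
  have "(\<Sum>k\<le>n. of_nat (n choose k) * (- 1) ^ k * mu_falling \<mu> (of_nat k) m)
      = (\<Sum>k\<le>n. \<Sum>p\<le>m. deg_stirling2 \<mu> m p
            * (of_nat (n choose k) * (- 1) ^ k * falling (of_nat k) p))"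
    by (simp add: mu_falling_eq_sum_deg_stirling2 sum_distrib_left mult_ac)
  also have "\<dots> = (\<Sum>p\<le>m. deg_stirling2 \<mu> m p
            * (\<Sum>k\<le>n. of_nat (n choose k) * (- 1) ^ k * falling (of_nat k) p))"
    by (subst sum.swap) (simp only: sum_distrib_left)
  also have "\<dots> = (\<Sum>p\<le>m. if n = p then deg_stirling2 \<mu> m n * ((- 1) ^ n * fact n) else 0)"
    by (intro sum.cong) (auto simp: alternating_binomial_sum_falling)
  also have "\<dots> = deg_stirling2 \<mu> m n * (- 1) ^ n * fact n"
    by (simp add: deg_stirling2_eq_0)
  finally show ?thesis .
qed

lemma sum_formal_comb_apply: "(\<Sum>k\<in>A. g k) m = (\<Sum>k\<in>A. g k m)"
  for g :: "'a \<Rightarrow> formal_comb"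
  by (induction A rule: infinite_finite_induct) simp_all

lemma alternating_deg_series_coeff:
  assumes "z \<noteq> 0"
  shows "(\<Sum>k\<le>n. (of_nat (n choose k) * (- 1) ^ k) \<odot> deg_series lam (z * of_nat k)) m
    = z ^ m * (deg_stirling2 (of_real lam / z) m n * (- 1) ^ n * fact n)"
  unfolding alternating_binomial_sum_mu_falling[symmetric] sum_formal_comb_apply sum_distrib_left
  by (intro sum.cong)
    (simp_all add: scale_def deg_series_coeff mu_falling_scale[OF assms] mult_ac)

lemma formal_sum_eq_sum:
  assumes "finite B" and "B \<subseteq> A" and "\<And>n. n \<in> A - B \<Longrightarrow> g n m = 0"
  shows "formal_sum g A m = (\<Sum>n\<in>B. g n m)"
  unfolding formal_sum_def by (rule sum.mono_neutral_left) (use assms in auto)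

theorem theorem12:
  fixes lam :: real and x z :: complex
  assumes "z \<noteq> 0"
  shows
    "formal_summable
       (\<lambda>n. (x ^ n / of_nat n) \<odot>
          (\<Sum>k\<le>n. (of_nat (n choose k) * (- 1) ^ k) \<odot> deg_series lam (z * of_nat k))) {1..}
     \<and> formal_sum
       (\<lambda>n. (x ^ n / of_nat n) \<odot>
          (\<Sum>k\<le>n. (of_nat (n choose k) * (- 1) ^ k) \<odot> deg_series lam (z * of_nat k))) {1..}
     = formal_sum
       (\<lambda>m. (z ^ m * (\<Sum>p = 1..m. deg_stirling2 (of_real lam / z) m p
               * (- 1) ^ p * fact (p - 1) * x ^ p)) \<odot> indet m) {1..}"
proof -
  define S where "S = deg_stirling2 (of_real lam / z)"
  let ?g = "\<lambda>n. (x ^ n / of_nat n) \<odot>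
    (\<Sum>k\<le>n. (of_nat (n choose k) * (- 1) ^ k) \<odot> deg_series lam (z * of_nat k))"
  have coeff: "?g n m = z ^ m * (S m n * (- 1) ^ n * fact (n - 1) * x ^ n)"
    if "n \<ge> 1" for n m
  proof -
    have "fact n = of_nat n * (fact (n - 1) :: complex)"
      using that by (simp add: fact_reduce)
    moreover have "?g n m = x ^ n / of_nat n * (z ^ m * (S m n * (- 1) ^ n * fact n))"
      by (subst scale_def) (simp only: alternating_deg_series_coeff[OF assms] S_def)
    ultimately show ?thesis
      using that by simp
  qed
  have vanish: "?g n m = 0" if "n \<in> {1..} - {1..m}" for n m
    using that coeff[of n m] deg_stirling2_eq_0[of m n] by (auto simp: S_def)
  have "formal_summable ?g {1..}"
    unfolding formal_summable_def
  proof
    fix m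
    have "{n \<in> {1..}. ?g n m \<noteq> 0} \<subseteq> {1..m}"
      using vanish[of _ m] by blast
    then show "finite {n \<in> {1..}. ?g n m \<noteq> 0}"
      by (rule finite_subset) simp
  qed
  moreover have "formal_sum ?g {1..} m = formal_sum
      (\<lambda>m. (z ^ m * (\<Sum>p = 1..m. S m p * (- 1) ^ p * fact (p - 1) * x ^ p)) \<odot> indet m) {1..} m"
    for m
  proof -
    have "formal_sum ?g {1..} m = (\<Sum>n = 1..m. ?g n m)"
      using vanish by (intro formal_sum_eq_sum) auto
    also have "\<dots> = z ^ m * (\<Sum>p = 1..m. S m p * (- 1) ^ p * fact (p - 1) * x ^ p)"
      unfolding sum_distrib_left by (rule sum.cong[OF refl], rule coeff) simp
    (* The coefficient of a_0 is absent on the right; on the left it is an empty sum. *)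
    finally show ?thesis
      by (auto simp: formal_sum_indet not_le)
  qed
  ultimately show ?thesis
    unfolding S_def by blast
qed

end
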